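(* Let $\lambda>0$, $x^c\in\mathbb{R}^n$, and let $\Gamma=\max\{A_f,\ell_f(\cdot;x^-)\}+h$, where $x^-\in\mathrm{dom}\,h$ and $A_f$ is an affine function with $A_f\le f$. Let $x=\mathrm{argmin}_{u\in\mathbb{R}^n}\{\Gamma(u)+\frac1{2\lambda}\|u-x^c\|^2\}$, and let $\theta\in[0,1]$ satisfy $$0\in\frac1\lambda(x-x^c)+\partial h(x)+\theta\nabla A_f+(1-\theta)f'(x^-),$$ $$\theta A_f(x)+(1-\theta)\ell_f(x;x^-)=\max\{A_f(x),\ell_f(x;x^-)\}.$$ Set $A_f^+:=\theta A_f+(1-\theta)\ell_f(\cdot;x^-)$, $\Gamma^+:=\max\{A_f^+,\ell_f(\cdot;x)\}+h$ and $\bar\Gamma:=A_f^++h$. Then, for any $\tau\in(0,1)$, $$\Gamma^+\in\overline{\mathrm{Conv}}_\mu(\mathbb{R}^n),\qquad\tau\bar\Gamma+(1-\tau)[\ell_f(\cdot;x)+h]\le\Gamma^+\le\phi,$$ and $$\bar\Gamma\in\overline{\mathrm{Conv}}_\mu(\mathbb{R}^n),\qquad\bar\Gamma(x)=\Gamma(x),\qquad x=\underset{u\in\mathbb{R}^n}{\mathrm{argmin}}\left\{\bar\Gamma(u)+\frac1{2\lambda}\|u-x^c\|^2\right\}.$$ As a consequence, $\Gamma^+$ (the two-cuts update (E2)) is a special implementation of the bundle update blackbox BU.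
   Context: For $\mu\ge0$, $\overline{\mathrm{Conv}}_\mu(\mathbb{R}^n)$ is the set of proper lower semicontinuous functions $\Psi:\mathbb{R}^n\to(-\infty,+\infty]$ such that $\Psi-\mu\|\cdot\|^2/2$ is convex. Standing assumptions: $f$ is proper lower semicontinuous convex on $\mathbb{R}^n$, $h\in\overline{\mathrm{Conv}}_\mu(\mathbb{R}^n)$, $\mathrm{dom}\,h\subset\mathrm{dom}\,f$, $\phi=f+h$, and $f':\mathrm{dom}\,h\to\mathbb{R}^n$ satisfies $f'(z)\in\partial f(z)$ for every $z\in\mathrm{dom}\,h$. $\ell_f(u;z)=f(z)+\langle f'(z),u-z\rangle$ for $z\in\mathrm{dom}\,h$. BU blackbox: given $(\lambda,\tau)\in(0,\infty)\times(0,1)$ and $(x^c,x,\Gamma)\in\mathbb{R}^n\times\mathbb{R}^n\times\overline{\mathrm{Conv}}_\mu(\mathbb{R}^n)$ with $\Gamma\le\phi$ and $x=\mathrm{argmin}_u\{\Gamma(u)+\frac1{2\lambda}\|u-x^c\|^2\}$, it outputs any $\Gamma^+\in\overline{\mathrm{Conv}}_\mu(\mathbb{R}^n)$ such that $\tau\bar\Gamma+(1-\tau)[\ell_f(\cdot;x)+h]\le\Gamma^+\le\phi$ for some $\bar\Gamma\in\overline{\mathrm{Conv}}_\mu(\mathbb{R}^n)$ with $\bar\Gamma(x)=\Gamma(x)$ and $x=\mathrm{argmin}_u\{\bar\Gamma(u)+\frac1{2\lambda}\|u-x^c\|^2\}$. *)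

theory Defs
  imports "HOL-Analysis.Analysis"
begin

definition eff_dom :: "('a \<Rightarrow> ereal) \<Rightarrow> 'a set" where
  "eff_dom F = {u. F u < \<infinity>}"

definition proper :: "('a \<Rightarrow> ereal) \<Rightarrow> bool" where
  "proper F \<longleftrightarrow> (\<forall>u. F u \<noteq> -\<infinity>) \<and> (\<exists>u. F u \<noteq> \<infinity>)"

definition lsc :: "('a::topological_space \<Rightarrow> ereal) \<Rightarrow> bool" where
  "lsc F \<longleftrightarrow> (\<forall>u. F u \<le> Liminf (at u) F)"

text \<open>Only applied to functions that never take the value \<open>-\<infinity>\<close>, so that the
  right-hand side is free of \<open>\<infinity> - \<infinity>\<close>.  At \<open>t = 0\<close> and \<open>t = 1\<close> the inequality is
  trivial because \<open>0 * \<infinity> = 0\<close> in \<^typ>\<open>ereal\<close>.\<close>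

definition ereal_convex :: "('a::real_vector \<Rightarrow> ereal) \<Rightarrow> bool" where
  "ereal_convex F \<longleftrightarrow> (\<forall>u v. \<forall>t\<in>{0..1::real}.
     F ((1 - t) *\<^sub>R u + t *\<^sub>R v) \<le> ereal (1 - t) * F u + ereal t * F v)"

definition Conv_lsc :: "real \<Rightarrow> ((real ^ 'n) \<Rightarrow> ereal) set" where
  "Conv_lsc \<mu> = {F. proper F \<and> lsc F \<and>
     ereal_convex (\<lambda>u. F u - ereal (\<mu> * (norm u)\<^sup>2 / 2))}"

definition subdiff :: "((real ^ 'n) \<Rightarrow> ereal) \<Rightarrow> real ^ 'n \<Rightarrow> (real ^ 'n) set" where
  "subdiff F z = {g. \<forall>u. F u \<ge> F z + ereal (g \<bullet> (u - z))}"

text \<open>The linearization of \<open>f\<close> at \<open>z\<close> is extended-real valued only by type: it is meant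
  for \<open>z\<close> with \<open>f z\<close> finite.\<close>

definition lin_approx ::
  "((real ^ 'n) \<Rightarrow> ereal) \<Rightarrow> (real ^ 'n \<Rightarrow> real ^ 'n) \<Rightarrow> real ^ 'n \<Rightarrow> real ^ 'n \<Rightarrow> ereal" where
  "lin_approx f f' z u = f z + ereal (f' z \<bullet> (u - z))"

definition affine_fun :: "((real ^ 'n) \<Rightarrow> real) \<Rightarrow> bool" where
  "affine_fun A \<longleftrightarrow> (\<exists>a b. \<forall>u. A u = a \<bullet> u + b)"

text \<open>\<open>x = argmin F\<close> is read as: \<open>x\<close> is the one and only global minimizer of \<open>F\<close>.\<close>

definition the_argmin :: "('a \<Rightarrow> ereal) \<Rightarrow> 'a \<Rightarrow> bool" where
  "the_argmin F x \<longleftrightarrow> {y. is_arg_min F (\<lambda>_. True) y} = {x}"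

definition prox_obj ::
  "((real ^ 'n) \<Rightarrow> ereal) \<Rightarrow> real \<Rightarrow> real ^ 'n \<Rightarrow> real ^ 'n \<Rightarrow> ereal" where
  "prox_obj F lam xc u = F u + ereal (1 / (2 * lam) * (norm (u - xc))\<^sup>2)"

definition BU_input ::
  "real \<Rightarrow> ((real ^ 'n) \<Rightarrow> ereal) \<Rightarrow> ((real ^ 'n) \<Rightarrow> ereal) \<Rightarrow> real \<Rightarrow> real \<Rightarrow>
   real ^ 'n \<Rightarrow> real ^ 'n \<Rightarrow> ((real ^ 'n) \<Rightarrow> ereal) \<Rightarrow> bool" where
  "BU_input \<mu> f h lam \<tau> xc x \<Gamma> \<longleftrightarrow>
     0 < lam \<and> 0 < \<tau> \<and> \<tau> < 1 \<and> \<Gamma> \<in> Conv_lsc \<mu> \<and> (\<forall>u. \<Gamma> u \<le> f u + h u) \<and>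
     the_argmin (prox_obj \<Gamma> lam xc) x"

text \<open>The blackbox may return any \<open>\<Gamma>\<^sup>+\<close> with the stated property, so it is a relation
  between an input and its admissible outputs rather than a function.\<close>

definition BU_output ::
  "real \<Rightarrow> ((real ^ 'n) \<Rightarrow> ereal) \<Rightarrow> ((real ^ 'n) \<Rightarrow> ereal) \<Rightarrow> (real ^ 'n \<Rightarrow> real ^ 'n) \<Rightarrow>
   real \<Rightarrow> real \<Rightarrow> real ^ 'n \<Rightarrow> real ^ 'n \<Rightarrow> ((real ^ 'n) \<Rightarrow> ereal) \<Rightarrow>
   ((real ^ 'n) \<Rightarrow> ereal) \<Rightarrow> bool" where
  "BU_output \<mu> f h f' lam \<tau> xc x \<Gamma> \<Gamma>p \<longleftrightarrow>
     \<Gamma>p \<in> Conv_lsc \<mu> \<and>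
     (\<exists>\<Gamma>b \<in> Conv_lsc \<mu>.
        (\<forall>u. ereal \<tau> * \<Gamma>b u + ereal (1 - \<tau>) * (lin_approx f f' x u + h u) \<le> \<Gamma>p u) \<and>
        (\<forall>u. \<Gamma>p u \<le> f u + h u) \<and>
        \<Gamma>b x = \<Gamma> x \<and>
        the_argmin (prox_obj \<Gamma>b lam xc) x)"

end

theory Submission
  imports Defs
begin

text \<open>
  Everything rests on writing the cuts as real affine functions: \<open>f\<close> is finite on
  \<open>dom h\<close>, so the linearizations at \<open>x\<^sup>-\<close> and at \<open>x\<close> are honest affine minorants of \<open>f\<close>,
  and so is the aggregated cut \<open>A\<^sub>f\<^sup>+\<close>, a convex combination of two such minorants.  Adding a
  continuous convex real function to \<open>h\<close> keeps it in the class (\<open>Conv_lsc_add_real\<close>), which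
  covers \<open>\<Gamma>\<close>, \<open>\<Gamma>\<^sup>+\<close> and \<open>\<Gamma>b\<close> at once; and a maximum of two minorants lies above each of
  their convex combinations and below \<open>f\<close>, which gives the two-sided bound.

  The only point with content is that \<open>x\<close> is also the prox point of \<open>\<Gamma>b\<close>.  The slope of
  \<open>A\<^sub>f\<^sup>+\<close> is \<open>\<theta> \<nabla>A\<^sub>f + (1 - \<theta>) f'(x\<^sup>-)\<close>, so the stationarity inclusion says that
  some subgradient of \<open>h\<close> at \<open>x\<close> cancels this slope plus the gradient of the quadratic.  The
  prox objective therefore exceeds its value at \<open>x\<close> by at least
  \<open>\<parallel>u - x\<parallel>\<^sup>2 / (2 \<lambda>)\<close>, which gives minimality and uniqueness together
  (\<open>the_argmin_prox_affine_plus\<close>).  The equality \<open>\<Gamma>b x = \<Gamma> x\<close> says that \<open>\<theta>\<close>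
  puts weight only on cuts active at \<open>x\<close>, which is the second hypothesis on \<open>\<theta>\<close>.
\<close>

section \<open>Adding a finite convex function\<close>

lemma lsc_add_real:
  fixes F :: "'a::t2_space \<Rightarrow> ereal" and g :: "'a \<Rightarrow> real"
  assumes F: "lsc F" and g: "\<And>u. isCont g u"
  shows "lsc (\<lambda>u. ereal (g u) + F u)"
  unfolding lsc_def le_Liminf_iff
proof (intro allI impI)
  fix u y assume y: "y < ereal (g u) + F u"
  then have "y - ereal (g u) < F u"
    by (cases y; cases "F u") auto
  \<comment> \<open>A real level \<open>z\<close> splits the bound: \<open>F\<close> stays above \<open>z\<close> near \<open>u\<close>, and \<open>g\<close> stays above \<open>y - z\<close>.\<close>
  then obtain z where z: "y - ereal (g u) < ereal z" "ereal z < F u"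
    using ereal_dense2 by blast
  have ev1: "eventually (\<lambda>x. ereal z < F x) (at u)"
    using F z(2) unfolding lsc_def le_Liminf_iff by blast
  have ev2: "eventually (\<lambda>x. y < ereal (g x) + ereal z) (at u)"
  proof (cases y)
    case (real r)
    then have "r - z < g u" using z(1) by simp
    with g[of u] have "eventually (\<lambda>x. r - z < g x) (at u)"
      unfolding isCont_def by (rule order_tendstoD(1))
    then show ?thesis by (rule eventually_mono) (simp add: real)
  qed (use y in auto)
  show "eventually (\<lambda>x. y < ereal (g x) + F x) (at u)"
    using ev1 ev2
  proof eventually_elim
    case (elim x)
    then show ?case by (cases "F x"; cases y) auto
  qed
qed

lemma ereal_convex_add_real:
  fixes F :: "'a::real_vector \<Rightarrow> ereal" and g :: "'a \<Rightarrow> real"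
  assumes F: "ereal_convex F" "\<And>u. F u \<noteq> -\<infinity>" and g: "convex_on UNIV g"
  shows "ereal_convex (\<lambda>u. ereal (g u) + F u)"
  unfolding ereal_convex_def
proof (intro allI ballI)
  fix u v :: 'a and t :: real assume t: "t \<in> {0..1}"
  let ?w = "(1 - t) *\<^sub>R u + t *\<^sub>R v"
  have "ereal (g ?w) + F ?w
    \<le> ereal ((1 - t) * g u + t * g v) + (ereal (1 - t) * F u + ereal t * F v)"
    using F(1) convex_onD[OF g] t unfolding ereal_convex_def
    by (intro add_mono) auto
  also have "\<dots> = ereal (1 - t) * (ereal (g u) + F u) + ereal t * (ereal (g v) + F v)"
    using t F(2)[of u] F(2)[of v]
    by (cases "F u"; cases "F v"; cases "t = 0"; cases "t = 1")
       (auto simp: algebra_simps)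
  finally show "ereal (g ?w) + F ?w
    \<le> ereal (1 - t) * (ereal (g u) + F u) + ereal t * (ereal (g v) + F v)" .
qed

lemma Conv_lsc_add_real:
  fixes F :: "real ^ 'n \<Rightarrow> ereal"
  assumes F: "F \<in> Conv_lsc \<mu>" and g: "convex_on UNIV g" "\<And>u. isCont g u"
  shows "(\<lambda>u. ereal (g u) + F u) \<in> Conv_lsc \<mu>"
proof -
  have p: "proper F" "lsc F" "ereal_convex (\<lambda>u. F u - ereal (\<mu> * (norm u)\<^sup>2 / 2))"
    using F by (auto simp: Conv_lsc_def)
  have "ereal_convex (\<lambda>u. ereal (g u) + (F u - ereal (\<mu> * (norm u)\<^sup>2 / 2)))"
    using p(3) _ g(1)
  proof (rule ereal_convex_add_real)
    show "F u - ereal (\<mu> * (norm u)\<^sup>2 / 2) \<noteq> -\<infinity>" for u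
      using p(1) by (cases "F u") (auto simp: proper_def)
  qed
  also have "(\<lambda>u. ereal (g u) + (F u - ereal (\<mu> * (norm u)\<^sup>2 / 2)))
    = (\<lambda>u. (ereal (g u) + F u) - ereal (\<mu> * (norm u)\<^sup>2 / 2))"
    by (simp add: fun_eq_iff minus_ereal_def add.assoc)
  finally show ?thesis
    using p lsc_add_real[OF p(2) g(2)] by (auto simp: Conv_lsc_def proper_def)
qed

lemma convex_on_max_affine:
  fixes a c :: "'a::real_inner" and b d :: real
  shows "convex_on UNIV (\<lambda>u. max (a \<bullet> u + b) (c \<bullet> u + d))"
proof (rule convex_onI)
  fix t :: real and x y :: 'a assume t: "0 < t" "t < 1"
  let ?M = "\<lambda>u. max (a \<bullet> u + b) (c \<bullet> u + d)"
  have *: "p \<bullet> ((1 - t) *\<^sub>R x + t *\<^sub>R y) + q = (1 - t) * (p \<bullet> x + q) + t * (p \<bullet> y + q)"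
    for p q by (simp add: inner_add_right algebra_simps)
  show "?M ((1 - t) *\<^sub>R x + t *\<^sub>R y) \<le> (1 - t) * ?M x + t * ?M y"
    unfolding * using t
    by (intro max.boundedI add_mono mult_left_mono) auto
qed auto

lemma Conv_lsc_max_affine_plus:
  fixes F :: "real ^ 'n \<Rightarrow> ereal"
  assumes "F \<in> Conv_lsc \<mu>"
  shows "(\<lambda>u. max (ereal (a \<bullet> u + b)) (ereal (c \<bullet> u + d)) + F u) \<in> Conv_lsc \<mu>"
proof -
  have "(\<lambda>u. ereal (max (a \<bullet> u + b) (c \<bullet> u + d)) + F u) \<in> Conv_lsc \<mu>"
    by (intro Conv_lsc_add_real assms convex_on_max_affine) (auto intro!: continuous_intros)
  then show ?thesis by (simp only: ereal_max[symmetric])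
qed

section \<open>Linearizations and prox points\<close>

lemma lin_approx_real:
  assumes "f z = ereal c"
  shows "lin_approx f f' z u = ereal (f' z \<bullet> u + (c - f' z \<bullet> z))"
  using assms by (simp add: lin_approx_def inner_diff_right)

lemma lin_approx_le:
  "f' z \<in> subdiff f z \<Longrightarrow> lin_approx f f' z u \<le> f u"
  by (simp add: subdiff_def lin_approx_def)

lemma the_argminI:
  assumes "\<And>u. u \<noteq> x \<Longrightarrow> F x < F u"
  shows "the_argmin F x"
  using assms unfolding the_argmin_def is_arg_min_def
  by (auto simp: set_eq_iff) (metis less_asym)+

lemma the_argminD: "the_argmin F x \<Longrightarrow> F x \<le> F u"
  unfolding the_argmin_def is_arg_min_def by (auto simp: set_eq_iff not_less)

text \<open>The subgradient supplied by stationarity cancels every term linear in \<open>u - x\<close>, so the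
  objective grows by at least \<open>\<parallel>u - x\<parallel>\<^sup>2 / (2 \<lambda>)\<close> away from \<open>x\<close>.  Being
  strict, this growth gives minimality and uniqueness at once.\<close>

lemma the_argmin_prox_affine_plus:
  fixes F :: "real ^ 'n \<Rightarrow> ereal"
  assumes lam: "lam > 0" and fin: "\<bar>F x\<bar> \<noteq> \<infinity>" and v: "v \<in> subdiff F x"
    and opt: "(1 / lam) *\<^sub>R (x - xc) + v + g = 0"
  shows "the_argmin (prox_obj (\<lambda>u. ereal (g \<bullet> u + b) + F u) lam xc) x"
proof (rule the_argminI)
  fix u assume ne: "u \<noteq> x"
  obtain c where c: "F x = ereal c" using fin by auto
  have F: "ereal (c + v \<bullet> (u - x)) \<le> F u" using v c by (simp add: subdiff_def)
  have lin: "v \<bullet> (u - x) = - (1 / lam) * ((x - xc) \<bullet> (u - x)) - g \<bullet> (u - x)"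
  proof -
    have "((1 / lam) *\<^sub>R (x - xc) + v + g) \<bullet> (u - x) = 0" using opt by simp
    then show ?thesis by (simp only: inner_add_left inner_scaleR_left)
  qed
  have n: "(norm (u - xc))\<^sup>2
    = (norm (x - xc))\<^sup>2 + 2 * ((x - xc) \<bullet> (u - x)) + (norm (u - x))\<^sup>2"
    by (simp add: power2_norm_eq_inner inner_diff_left inner_diff_right inner_commute)
  have quad: "1 / (2 * lam) * (norm (u - xc))\<^sup>2 = 1 / (2 * lam) * (norm (x - xc))\<^sup>2
      + (1 / lam) * ((x - xc) \<bullet> (u - x)) + 1 / (2 * lam) * (norm (u - x))\<^sup>2"
    unfolding n using lam by (simp add: field_simps)
  have pos: "0 < 1 / (2 * lam) * (norm (u - x))\<^sup>2" using lam ne by simp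
  have "(g \<bullet> x + b) + c + 1 / (2 * lam) * (norm (x - xc))\<^sup>2
      < (g \<bullet> u + b) + (c + v \<bullet> (u - x)) + 1 / (2 * lam) * (norm (u - xc))\<^sup>2"
    unfolding quad lin using pos by (simp add: inner_diff_right)
  then have "prox_obj (\<lambda>u. ereal (g \<bullet> u + b) + F u) lam xc x
      < ereal ((g \<bullet> u + b) + (c + v \<bullet> (u - x)) + 1 / (2 * lam) * (norm (u - xc))\<^sup>2)"
    by (simp add: prox_obj_def c)
  also have "\<dots> \<le> prox_obj (\<lambda>u. ereal (g \<bullet> u + b) + F u) lam xc u"
    using F by (cases "F u") (auto simp: prox_obj_def)
  finally show "prox_obj (\<lambda>u. ereal (g \<bullet> u + b) + F u) lam xc x
      < prox_obj (\<lambda>u. ereal (g \<bullet> u + b) + F u) lam xc u" .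
qed

lemma GDERIV_affine_unique:
  assumes "\<And>u. A u = a \<bullet> u + b" "GDERIV A z :> g"
  shows "g = a"
proof -
  have eq: "A = (\<lambda>u. a \<bullet> u + b)" using assms(1) by auto
  have "(A has_derivative (\<lambda>h. a \<bullet> h)) (at z)"
    unfolding eq by (auto intro!: derivative_eq_intros)
  with assms(2) have "(\<lambda>h. h \<bullet> g) = (\<lambda>h. a \<bullet> h)"
    unfolding gderiv_def by (rule has_derivative_unique)
  then have "(g - a) \<bullet> (g - a) = 0"
    by (metis inner_commute inner_diff_right right_minus_eq)
  then show ?thesis by simp
qed

section \<open>The two-cuts update\<close>

theorem propositionD1:
  fixes f h \<phi> :: "real ^ 'n \<Rightarrow> ereal"
    and f' :: "real ^ 'n \<Rightarrow> real ^ 'n"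
    and \<mu> lam \<theta> :: real
    and xc xm x gradA :: "real ^ 'n"
    and A :: "real ^ 'n \<Rightarrow> real"
    and \<Gamma> Ap \<Gamma>p \<Gamma>b :: "real ^ 'n \<Rightarrow> ereal"
  assumes mu: "\<mu> \<ge> 0"
    and f: "proper f" "lsc f" "ereal_convex f"
    and h: "h \<in> Conv_lsc \<mu>"
    and dom: "eff_dom h \<subseteq> eff_dom f"
    and phi: "\<phi> = (\<lambda>u. f u + h u)"
    and f': "\<forall>z \<in> eff_dom h. f' z \<in> subdiff f z"
    and lam: "lam > 0"
    and xm: "xm \<in> eff_dom h"
    and A: "affine_fun A" "\<forall>u. ereal (A u) \<le> f u"
    and gradA: "\<forall>u. GDERIV A u :> gradA"
    and Gamma: "\<Gamma> = (\<lambda>u. max (ereal (A u)) (lin_approx f f' xm u) + h u)"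
    and x: "the_argmin (prox_obj \<Gamma> lam xc) x"
    and theta: "\<theta> \<in> {0..1}"
    and opt: "0 \<in> {(1 / lam) *\<^sub>R (x - xc) + v + \<theta> *\<^sub>R gradA + (1 - \<theta>) *\<^sub>R f' xm | v. v \<in> subdiff h x}"
    and active: "ereal \<theta> * ereal (A x) + ereal (1 - \<theta>) * lin_approx f f' xm x
                 = max (ereal (A x)) (lin_approx f f' xm x)"
    and Ap: "Ap = (\<lambda>u. ereal \<theta> * ereal (A u) + ereal (1 - \<theta>) * lin_approx f f' xm u)"
    and Gammap: "\<Gamma>p = (\<lambda>u. max (Ap u) (lin_approx f f' x u) + h u)"
    and Gammab: "\<Gamma>b = (\<lambda>u. Ap u + h u)"
  shows "\<forall>\<tau>. 0 < \<tau> \<and> \<tau> < 1 \<longrightarrow>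
           \<Gamma>p \<in> Conv_lsc \<mu> \<and>
           (\<forall>u. ereal \<tau> * \<Gamma>b u + ereal (1 - \<tau>) * (lin_approx f f' x u + h u) \<le> \<Gamma>p u) \<and>
           (\<forall>u. \<Gamma>p u \<le> \<phi> u) \<and>
           \<Gamma>b \<in> Conv_lsc \<mu> \<and>
           \<Gamma>b x = \<Gamma> x \<and>
           the_argmin (prox_obj \<Gamma>b lam xc) x \<and>
           BU_input \<mu> f h lam \<tau> xc x \<Gamma> \<and>
           BU_output \<mu> f h f' lam \<tau> xc x \<Gamma> \<Gamma>p"
proof -
  obtain b where Aab: "\<And>u. A u = gradA \<bullet> u + b"
  proof -
    obtain a b where ab: "\<And>u. A u = a \<bullet> u + b" using A(1) by (auto simp: affine_fun_def)
    have "gradA = a" using GDERIV_affine_unique[OF ab] gradA by blast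
    with ab that show ?thesis by blast
  qed
  have hninf: "h u \<noteq> -\<infinity>" for u using h by (auto simp: Conv_lsc_def proper_def)
  have f_real: "\<exists>c. f z = ereal c" if "z \<in> eff_dom h" for z
  proof -
    have "f z < \<infinity>" using that dom by (auto simp: eff_dom_def)
    moreover have "f z \<noteq> -\<infinity>" using f(1) by (simp add: proper_def)
    ultimately show ?thesis by (cases "f z") auto
  qed
  obtain cm where cm: "f xm = ereal cm" using f_real[OF xm] by blast
  define dm where "dm = cm - f' xm \<bullet> xm"
  have lm: "lin_approx f f' xm u = ereal (f' xm \<bullet> u + dm)" for u
    using lin_approx_real[of f xm, OF cm] unfolding dm_def .
  have Gamma': "\<Gamma> = (\<lambda>u. max (ereal (gradA \<bullet> u + b)) (ereal (f' xm \<bullet> u + dm)) + h u)"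
    by (simp only: Gamma lm Aab)
  \<comment> \<open>The objective of \<open>\<Gamma>\<close> is finite at \<open>x\<^sup>-\<close>, hence at its minimizer, so \<open>f' x\<close> is a subgradient.\<close>
  have xh: "x \<in> eff_dom h"
  proof -
    have "prox_obj \<Gamma> lam xc x \<le> prox_obj \<Gamma> lam xc xm" using x by (rule the_argminD)
    moreover have "prox_obj \<Gamma> lam xc xm < \<infinity>"
      using xm by (cases "h xm") (auto simp: prox_obj_def Gamma' eff_dom_def simp flip: ereal_max)
    ultimately have "prox_obj \<Gamma> lam xc x < \<infinity>" by (rule le_less_trans)
    then show ?thesis
      by (cases "h x") (auto simp: prox_obj_def Gamma' eff_dom_def)
  qed
  obtain cx where cx: "f x = ereal cx" using f_real[OF xh] by blast
  define dx where "dx = cx - f' x \<bullet> x"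
  have lx: "lin_approx f f' x u = ereal (f' x \<bullet> u + dx)" for u
    using lin_approx_real[of f x, OF cx] unfolding dx_def .
  have lm_le: "ereal (f' xm \<bullet> u + dm) \<le> f u" for u
    using lin_approx_le[of f' xm f u] f' xm by (simp add: lm)
  have lx_le: "ereal (f' x \<bullet> u + dx) \<le> f u" for u
    using lin_approx_le[of f' x f u] f' xh by (simp add: lx)
  have A_le: "ereal (gradA \<bullet> u + b) \<le> f u" for u
    using A(2) by (simp only: Aab)

  define g where "g = \<theta> *\<^sub>R gradA + (1 - \<theta>) *\<^sub>R f' xm"
  define e where "e = \<theta> * b + (1 - \<theta>) * dm"
  have Ap_real: "Ap u = ereal (g \<bullet> u + e)" for u
    by (simp add: Ap lm Aab g_def e_def inner_add_left algebra_simps)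
  have Ap_le: "ereal (g \<bullet> u + e) \<le> f u" for u
  proof (cases "f u")
    case (real r)
    have "g \<bullet> u + e = \<theta> * (gradA \<bullet> u + b) + (1 - \<theta>) * (f' xm \<bullet> u + dm)"
      by (simp add: g_def e_def inner_add_left algebra_simps)
    also have "\<dots> \<le> r"
      using convex_bound_le[of "gradA \<bullet> u + b" r "f' xm \<bullet> u + dm" \<theta> "1 - \<theta>"]
        A_le[of u] lm_le[of u] theta real by auto
    finally show ?thesis using real by simp
  qed (use f(1) in \<open>auto simp: proper_def\<close>)

  have Gp: "\<Gamma>p = (\<lambda>u. max (ereal (g \<bullet> u + e)) (ereal (f' x \<bullet> u + dx)) + h u)"
    by (simp only: Gammap Ap_real lx)
  have Gb: "\<Gamma>b = (\<lambda>u. ereal (g \<bullet> u + e) + h u)"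
    by (simp only: Gammab Ap_real)

  have c\<Gamma>: "\<Gamma> \<in> Conv_lsc \<mu>"
    unfolding Gamma' by (rule Conv_lsc_max_affine_plus[OF h])
  have cp: "\<Gamma>p \<in> Conv_lsc \<mu>"
    unfolding Gp by (rule Conv_lsc_max_affine_plus[OF h])
  have cb: "\<Gamma>b \<in> Conv_lsc \<mu>"
    using Conv_lsc_max_affine_plus[OF h, of g e g e] unfolding Gb by (simp only: max.idem)
  have \<Gamma>_le: "\<Gamma> u \<le> f u + h u" for u
    unfolding Gamma' using A_le lm_le by (intro add_right_mono max.boundedI)
  have p_le: "\<Gamma>p u \<le> f u + h u" for u
    unfolding Gp using Ap_le lx_le by (intro add_right_mono max.boundedI)
  have lower: "ereal \<tau> * \<Gamma>b u + ereal (1 - \<tau>) * (lin_approx f f' x u + h u) \<le> \<Gamma>p u"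
    if \<tau>: "0 < \<tau>" "\<tau> < 1" for \<tau> u
  proof (cases "h u")
    case (real r)
    let ?p = "g \<bullet> u + e" and ?q = "f' x \<bullet> u + dx"
    have "\<tau> * (?p + r) + (1 - \<tau>) * (?q + r) \<le> max ?p ?q + r"
      by (rule convex_bound_le) (use \<tau> in auto)
    then show ?thesis by (simp add: Gb Gp lx real flip: ereal_max)
  qed (use \<tau> hninf in \<open>auto simp: Gp simp flip: ereal_max\<close>)
  have bx: "\<Gamma>b x = \<Gamma> x"
    unfolding Gammab Gamma Ap using active by simp
  have argb: "the_argmin (prox_obj \<Gamma>b lam xc) x"
  proof -
    obtain v where "v \<in> subdiff h x" "(1 / lam) *\<^sub>R (x - xc) + v + g = 0"
      using opt unfolding g_def by (auto simp: add.assoc)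
    moreover have "\<bar>h x\<bar> \<noteq> \<infinity>" using xh hninf[of x] by (auto simp: eff_dom_def)
    ultimately show ?thesis unfolding Gb using lam by (intro the_argmin_prox_affine_plus)
  qed
  show ?thesis
    using c\<Gamma> cp cb \<Gamma>_le p_le lower bx argb lam x
    unfolding phi BU_input_def BU_output_def by blast
qed

end
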